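(* Let $V$ be a vector space of dimension $d$ over the finite field $\mathbb{F}_q$, with dual $V^*$ and evaluation pairing $\langle\cdot,\cdot\rangle: V\times V^*\to\mathbb{F}_q$, and let $\psi:\mathbb{F}_q\to\mathbb{C}^\times$ be a nontrivial additive character. Put $$X(\mathbb{F}_q)=\{(v,v^\vee)\in V\times V^*:\langle v,v^\vee\rangle=0\},\qquad \lambda\cdot(v,v^\vee)=(\lambda v,\lambda v^\vee)\ \ (\lambda\in\mathbb{F}_q^\times),$$ $$\mathcal{S}(X(\mathbb{F}_q),\mathbb{C})=\Big\{f:X(\mathbb{F}_q)\to\mathbb{C}\ :\ \sum_{\lambda\in\mathbb{F}_q^\times}f(\lambda x)=0\ \text{ for all }x\in X(\mathbb{F}_q)\Big\}.$$ For $x=(u,u^\vee)$ and $y=(v,v^\vee)$ in $X(\mathbb{F}_q)$ let $K(x,y)=\mathrm{Kl}(\langle u,v^\vee\rangle+\langle v,u^\vee\rangle)$, and for $f:X(\mathbb{F}_q)\to\mathbb{C}$ define $$\mathcal{F}(f)(y)=\sum_{x\in X(\mathbb{F}_q)}f(x)K(x,y).$$ Then for all $f\in\mathcal{S}(X(\mathbb{F}_q),\mathbb{C})$, $$\mathcal{F}^2(f)=q^{2d}f.$$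
   Context: $\mathrm{Kl}(a)=\sum_{t\in\mathbb{F}_q^\times}\psi\left(\frac{a}{t}+t\right)$ for $a\in\mathbb{F}_q$ is the Kloosterman sum attached to $\psi$. $\mathcal{F}^2=\mathcal{F}\circ\mathcal{F}$. *)

theory Defs
  imports Complex_Main "HOL-Library.Cardinality"
begin

text \<open>
  The vector space \<open>V\<close> is the whole type \<open>'v\<close>, with scalar multiplication \<open>s\<close> (in the sense of the
  locale \<^locale>\<open>vector_space\<close>) over a finite field \<open>'k\<close>.  The dual \<open>V\<^sup>*\<close> is the set of linear functionals
  inside \<open>'v \<Rightarrow> 'k\<close>, and the evaluation pairing of \<open>v\<close> and \<open>\<phi>\<close> is the application \<open>\<phi> v\<close>.
\<close>

definition dual_space :: "('k::field \<Rightarrow> 'v::ab_group_add \<Rightarrow> 'v) \<Rightarrow> ('v \<Rightarrow> 'k) set" where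
  "dual_space s = {\<phi>. Vector_Spaces.linear s (*) \<phi>}"

definition pairing :: "'v \<Rightarrow> ('v \<Rightarrow> 'k) \<Rightarrow> 'k" where
  "pairing v \<phi> = \<phi> v"

definition cone :: "('k::field \<Rightarrow> 'v::ab_group_add \<Rightarrow> 'v) \<Rightarrow> ('v \<times> ('v \<Rightarrow> 'k)) set" where
  "cone s = {(v, \<phi>). \<phi> \<in> dual_space s \<and> pairing v \<phi> = 0}"

definition cone_scale ::
  "('k::field \<Rightarrow> 'v \<Rightarrow> 'v) \<Rightarrow> 'k \<Rightarrow> 'v \<times> ('v \<Rightarrow> 'k) \<Rightarrow> 'v \<times> ('v \<Rightarrow> 'k)" where
  "cone_scale s c x = (s c (fst x), \<lambda>w. c * snd x w)"

definition nontrivial_additive_character :: "('k::field \<Rightarrow> complex) \<Rightarrow> bool" where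
  "nontrivial_additive_character \<psi> \<longleftrightarrow>
     (\<forall>a. \<psi> a \<noteq> 0) \<and> (\<forall>a b. \<psi> (a + b) = \<psi> a * \<psi> b) \<and> (\<exists>a. \<psi> a \<noteq> 1)"

definition kloosterman :: "('k::{field,finite} \<Rightarrow> complex) \<Rightarrow> 'k \<Rightarrow> complex" where
  "kloosterman \<psi> a = (\<Sum>t\<in>UNIV - {0}. \<psi> (a / t + t))"

text \<open>
  A function on the cone is represented by a function on the ambient type
  \<open>'v \<times> ('v \<Rightarrow> 'k)\<close>; its values outside the cone are irrelevant to everything below, so
  equality of functions on the cone is equality at all points of the cone.
\<close>

definition schwartz_space ::
  "('k::{field,finite} \<Rightarrow> 'v::ab_group_add \<Rightarrow> 'v) \<Rightarrow> ('v \<times> ('v \<Rightarrow> 'k) \<Rightarrow> complex) set" where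
  "schwartz_space s = {f. \<forall>x\<in>cone s. (\<Sum>c\<in>UNIV - {0}. f (cone_scale s c x)) = 0}"

definition kernel ::
  "('k::{field,finite} \<Rightarrow> complex) \<Rightarrow> 'v \<times> ('v \<Rightarrow> 'k) \<Rightarrow> 'v \<times> ('v \<Rightarrow> 'k) \<Rightarrow> complex" where
  "kernel \<psi> x y = kloosterman \<psi> (pairing (fst x) (snd y) + pairing (fst y) (snd x))"

text \<open>The cone is finite when \<open>V\<close> is finite-dimensional, so the sum is a genuine finite sum there.\<close>

definition fourier ::
  "('k::{field,finite} \<Rightarrow> 'v::ab_group_add \<Rightarrow> 'v) \<Rightarrow> ('k \<Rightarrow> complex) \<Rightarrow>
   ('v \<times> ('v \<Rightarrow> 'k) \<Rightarrow> complex) \<Rightarrow> 'v \<times> ('v \<Rightarrow> 'k) \<Rightarrow> complex" where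
  "fourier s \<psi> f y = (\<Sum>x\<in>cone s. f x * kernel \<psi> x y)"

end

theory Submission
  imports Defs "HOL-Library.FuncSet"
begin

text \<open>
  Write the indicator function of the cone inside \<open>V \<times> V\<^sup>*\<close> as the average of
  \<open>\<psi> (c * \<phi> v)\<close> over the scalars \<open>c\<close> and open the two Kloosterman sums.  The composed kernel
  at \<open>(x, z)\<close> then becomes a sum of character sums over all of \<open>V \<times> V\<^sup>*\<close>.  The term \<open>c = 0\<close> is
  supported on the multiples \<open>x\<close> of \<open>z\<close>; integrated against \<open>f\<close> it gives \<open>q\<^sup>2\<^sup>d f(z)\<close>, up to a
  multiple of the sum of \<open>f\<close> over the orbit of \<open>z\<close>, which vanishes.  The terms \<open>c \<noteq> 0\<close> are
  Gaussian sums, which depend on \<open>x\<close> only through \<open>\<psi> (c * k * bilin x z)\<close> with \<open>k\<close> independent of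
  \<open>x\<close>; summed over \<open>c\<close> this is invariant under scaling of \<open>x\<close>, so it is orthogonal to the
  functions all of whose orbit sums vanish.
\<close>

text \<open>The common source of the orthogonality relations below: \<open>\<tau>\<close> will be a
  translation and \<open>c\<close> the value of \<open>\<psi>\<close> by which it multiplies each
  term.\<close>

lemma sum_char_translate_eq_0:
  fixes h :: "'a \<Rightarrow> complex"
  assumes "bij_betw \<tau> A A" and "\<And>x. x \<in> A \<Longrightarrow> h (\<tau> x) = c * h x" and "c \<noteq> 1"
  shows "sum h A = 0"
proof -
  have "sum h A = (\<Sum>x\<in>A. h (\<tau> x))"
    using sum.reindex_bij_betw[OF assms(1), of h] by simp
  also have "\<dots> = c * sum h A"
    using assms(2) by (simp add: sum_distrib_left)
  finally show ?thesis using assms(3) by simp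
qed

lemma bij_betw_times_units:
  fixes a :: "'k::field"
  assumes "a \<noteq> 0"
  shows "bij_betw ((*) a) (UNIV - {0}) (UNIV - {0})"
  using assms by (intro bij_betwI[where g = "\<lambda>x. x / a"]) auto

lemma bij_betw_divide_units:
  fixes a :: "'k::field"
  assumes "a \<noteq> 0"
  shows "bij_betw ((/) a) (UNIV - {0}) (UNIV - {0})"
  using assms by (intro bij_betwI[where g = "(/) a"]) auto

locale finite_quadric_cone = finite_dimensional_vector_space s B
  for s :: "'k::{field,finite} \<Rightarrow> 'v::ab_group_add \<Rightarrow> 'v" and B :: "'v set" +
  fixes \<psi> :: "'k \<Rightarrow> complex"
  assumes char: "nontrivial_additive_character \<psi>"
begin

lemma vector_space_mult: "vector_space ((*) :: 'k \<Rightarrow> 'k \<Rightarrow> 'k)"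
  by unfold_locales (auto simp: algebra_simps)

lemma vector_space_pair_mult: "vector_space_pair s ((*) :: 'k \<Rightarrow> 'k \<Rightarrow> 'k)"
  using vector_space_axioms vector_space_mult by (rule vector_space_pair.intro)

abbreviation dual :: "('v \<Rightarrow> 'k) set" where "dual \<equiv> dual_space s"
abbreviation units :: "'k set" where "units \<equiv> UNIV - {0}"

section \<open>Additive characters of the field\<close>

lemma char_add: "\<psi> (a + b) = \<psi> a * \<psi> b"
  using char by (simp add: nontrivial_additive_character_def)

lemma char_0 [simp]: "\<psi> 0 = 1"
proof -
  have "\<psi> 0 \<noteq> 0" using char by (simp add: nontrivial_additive_character_def)
  then show ?thesis using char_add[of 0 0] by simp
qed

lemma char_scaled_nontrivial:
  assumes "a \<noteq> 0"
  obtains t where "\<psi> (t * a) \<noteq> 1"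
proof -
  obtain b where "\<psi> b \<noteq> 1" using char by (auto simp: nontrivial_additive_character_def)
  then have "\<psi> ((b / a) * a) \<noteq> 1" using assms by simp
  then show ?thesis by (rule that)
qed

lemma sum_char_field: "(\<Sum>t\<in>UNIV. \<psi> (t * a)) = (if a = 0 then of_nat CARD('k) else 0)"
proof (cases "a = 0")
  case False
  then obtain b where b: "\<psi> (b * a) \<noteq> 1" by (rule char_scaled_nontrivial)
  have "(\<Sum>t\<in>UNIV. \<psi> (t * a)) = 0"
    by (rule sum_char_translate_eq_0[where \<tau> = "(+) b", OF _ _ b])
       (auto simp: char_add algebra_simps)
  then show ?thesis using False by simp
qed simp

lemma sum_char_units: "(\<Sum>t\<in>units. \<psi> (t * a)) = (if a = 0 then of_nat CARD('k) else 0) - 1"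
  using sum.remove[of UNIV 0 "\<lambda>t. \<psi> (t * a)"] by (simp add: sum_char_field)

section \<open>The dual space and its size\<close>

lemma dual_iff:
  "\<phi> \<in> dual \<longleftrightarrow> (\<forall>u v. \<phi> (u + v) = \<phi> u + \<phi> v) \<and> (\<forall>c v. \<phi> (s c v) = c * \<phi> v)"
  using vector_space_axioms vector_space_mult
  by (simp add: dual_space_def Vector_Spaces.linear_iff)

lemma dualI:
  assumes "\<And>u v. \<phi> (u + v) = \<phi> u + \<phi> v" and "\<And>c v. \<phi> (s c v) = c * \<phi> v"
  shows "\<phi> \<in> dual"
  using assms by (simp add: dual_iff)

lemma dual_add: "\<phi> \<in> dual \<Longrightarrow> \<phi> (u + v) = \<phi> u + \<phi> v"
  and dual_scale: "\<phi> \<in> dual \<Longrightarrow> \<phi> (s c v) = c * \<phi> v"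
  by (simp_all add: dual_iff)

lemma dual_zero: "\<phi> \<in> dual \<Longrightarrow> \<phi> 0 = 0"
  using dual_scale[of \<phi> 0 0] by simp

lemma zero_in_dual: "(\<lambda>_. 0) \<in> dual"
  by (rule dualI) simp_all

lemma dual_minus: "\<phi> \<in> dual \<Longrightarrow> \<phi> (- v) = - \<phi> v"
  using dual_scale[of \<phi> "-1" v] by simp

lemma dual_combination:
  assumes "\<alpha> \<in> dual" "\<beta> \<in> dual"
  shows "(\<lambda>v. a * \<alpha> v + b * \<beta> v) \<in> dual"
  by (rule dualI) (simp_all add: dual_add[OF assms(1)] dual_add[OF assms(2)]
      dual_scale[OF assms(1)] dual_scale[OF assms(2)] algebra_simps)

lemma dual_scaled: "\<alpha> \<in> dual \<Longrightarrow> (\<lambda>v. a * \<alpha> v) \<in> dual"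
  using dual_combination[of \<alpha> \<alpha> a 0] by simp

lemma bij_betw_dual_translate:
  assumes "\<alpha> \<in> dual"
  shows "bij_betw (\<lambda>\<phi> v. \<alpha> v + \<phi> v) dual dual"
  using dual_combination[OF assms, of _ 1 1] dual_combination[OF assms, of _ "-1" 1]
  by (intro bij_betwI[where g = "\<lambda>\<phi> v. - \<alpha> v + \<phi> v"]) auto

text \<open>Values on a basis determine a functional and can be prescribed freely. Both finiteness
  and cardinality of \<open>dual\<close> are read off from this.\<close>

lemma bij_betw_dual_functions: "bij_betw (\<lambda>\<phi>. restrict \<phi> B) dual (B \<rightarrow>\<^sub>E UNIV)"
proof (rule bij_betw_imageI)
  show "inj_on (\<lambda>\<phi>. restrict \<phi> B) dual"
  proof (rule inj_onI)
    fix \<phi> \<chi> assume lin: "\<phi> \<in> dual" "\<chi> \<in> dual" and eq: "restrict \<phi> B = restrict \<chi> B"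
    have "\<phi> b = \<chi> b" if "b \<in> B" for b
      using fun_cong[OF eq, of b] that by simp
    then show "\<phi> = \<chi>"
      using lin vector_space_pair.linear_eq_on[OF vector_space_pair_mult, of \<phi> \<chi> _ B] by (auto simp: dual_space_def span_Basis)
  qed
  show "(\<lambda>\<phi>. restrict \<phi> B) ` dual = B \<rightarrow>\<^sub>E UNIV"
  proof (intro equalityI subsetI)
    fix g :: "'v \<Rightarrow> 'k" assume g: "g \<in> B \<rightarrow>\<^sub>E UNIV"
    obtain \<phi> where \<phi>: "Vector_Spaces.linear s (*) \<phi>" "\<forall>b\<in>B. \<phi> b = g b"
      using vector_space_pair.linear_independent_extend
        [OF vector_space_pair_mult independent_Basis] by blast
    have "g = restrict \<phi> B"
    proof
      \<comment> \<open>Outside \<open>B\<close> both sides are \<open>undefined\<close>.\<close>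
      show "g b = restrict \<phi> B b" for b
        using \<phi>(2) PiE_arb[OF g] by (cases "b \<in> B") auto
    qed
    moreover have "\<phi> \<in> dual" using \<phi>(1) by (simp add: dual_space_def)
    ultimately show "g \<in> (\<lambda>\<phi>. restrict \<phi> B) ` dual" by (rule image_eqI)
  qed auto
qed

lemma finite_dual: "finite dual"
  using bij_betw_finite[OF bij_betw_dual_functions] finite_Basis by (simp add: finite_PiE)

lemma card_dual: "card dual = CARD('k) ^ dim UNIV"
  using bij_betw_same_card[OF bij_betw_dual_functions] finite_Basis by (simp add: card_funcsetE)

lemma dual_separates:
  assumes "v \<noteq> 0"
  obtains \<alpha> where "\<alpha> \<in> dual" "\<alpha> v = 1"
proof -
  have "independent {v}" using assms by simp
  then obtain \<alpha> where "Vector_Spaces.linear s (*) \<alpha>" "\<alpha> v = 1"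
    using vector_space_pair.linear_independent_extend
      [OF vector_space_pair_mult, of "{v}" "\<lambda>_. 1"] by auto
  then show ?thesis using that by (simp add: dual_space_def)
qed

lemma finite_vectors: "finite (UNIV :: 'v set)"
proof -
  have "(UNIV :: 'v set) \<subseteq> (\<lambda>g. \<Sum>b\<in>B. s (g b) b) ` (B \<rightarrow>\<^sub>E UNIV)"
  proof
    fix v :: 'v
    have "v \<in> span B" by (simp add: span_Basis)
    then obtain g where "v = (\<Sum>b\<in>B. s (g b) b)"
      by (auto simp: span_finite[OF finite_Basis])
    \<comment> \<open>Only the values of \<open>g\<close> on \<open>B\<close> matter; restricting
      puts the coefficients into a finite set of functions.\<close>
    then have "v = (\<Sum>b\<in>B. s (restrict g B b) b)" by simp
    then show "v \<in> (\<lambda>g. \<Sum>b\<in>B. s (g b) b) ` (B \<rightarrow>\<^sub>E UNIV)"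
      by (rule image_eqI[where x = "restrict g B"]) simp
  qed
  then show ?thesis
    using finite_Basis by (rule finite_subset[OF _ finite_imageI[OF finite_PiE]]) simp
qed

section \<open>Orthogonality of characters on \<open>V\<close> and its dual\<close>

lemma sum_char_dual: "(\<Sum>\<phi>\<in>dual. \<psi> (\<phi> v)) = (if v = 0 then of_nat (card dual) else 0)"
proof (cases "v = 0")
  case False
  then obtain \<alpha> where \<alpha>: "\<alpha> \<in> dual" "\<alpha> v = 1" by (rule dual_separates)
  obtain b where b: "\<psi> (b * 1) \<noteq> 1" by (rule char_scaled_nontrivial[of 1]) auto
  \<comment> \<open>Adding the functional \<open>b * \<alpha>\<close> to \<open>\<phi>\<close>
    shifts \<open>\<phi> v\<close> by \<open>b\<close>, so each term is multiplied by
    \<open>\<psi> b\<close>.\<close>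
  have "(\<Sum>\<phi>\<in>dual. \<psi> (\<phi> v)) = 0"
    by (rule sum_char_translate_eq_0[OF bij_betw_dual_translate[OF dual_scaled[OF \<alpha>(1), of b]] _ b])
       (simp add: char_add \<alpha>)
  then show ?thesis using False by simp
qed (simp add: dual_zero)

lemma sum_char_vectors:
  assumes "\<alpha> \<in> dual"
  shows "(\<Sum>v\<in>UNIV. \<psi> (\<alpha> v)) = (if \<alpha> = (\<lambda>_. 0) then of_nat (CARD('v)) else 0)"
proof (cases "\<alpha> = (\<lambda>_. 0)")
  case False
  then obtain v where v: "\<alpha> v \<noteq> 0" by auto
  obtain b where b: "\<psi> (b * \<alpha> v) \<noteq> 1" by (rule char_scaled_nontrivial[OF v])
  have "(\<Sum>v\<in>UNIV. \<psi> (\<alpha> v)) = 0"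
    by (rule sum_char_translate_eq_0[where \<tau> = "(+) (s b v)", OF _ _ b])
       (auto simp: dual_add dual_scale assms char_add)
  then show ?thesis using False by simp
qed simp

text \<open>Double counting: the sum of \<open>\<psi> (\<phi> v)\<close> over all pairs reduces to
  \<open>v = 0\<close> when \<open>\<phi>\<close> is summed first, and to the zero functional when
  \<open>v\<close> is summed first.\<close>

lemma card_vectors: "CARD('v) = card dual"
proof -
  have "of_nat (card dual) = (\<Sum>v\<in>UNIV. \<Sum>\<phi>\<in>dual. \<psi> (\<phi> v))"
    using finite_vectors by (simp add: sum_char_dual)
  also have "\<dots> = (\<Sum>\<phi>\<in>dual. \<Sum>v\<in>UNIV. \<psi> (\<phi> v))"
    by (rule sum.swap)
  also have "\<dots> = (\<Sum>\<phi>\<in>dual. if \<phi> = (\<lambda>_. 0) then of_nat (CARD('v)) else 0)"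
    by (intro sum.cong) (auto simp: sum_char_vectors)
  also have "\<dots> = of_nat (CARD('v))"
    using finite_dual zero_in_dual by simp
  finally show ?thesis by simp
qed

section \<open>Character sums over the cone\<close>

lemma finite_cone: "finite (cone s)"
  by (rule finite_subset[of _ "UNIV \<times> dual"])
     (auto simp: cone_def finite_vectors finite_dual)

text \<open>The quadratic form \<open>\<phi> v\<close> is split, so the Gaussian sum is elementary:
  the exponent is linear in \<open>\<phi>\<close>, and summing over \<open>\<phi>\<close> forces
  \<open>u + c v = 0\<close>. For nonzero \<open>c\<close> this leaves a single \<open>v\<close>;
  for \<open>c = 0\<close> the sum over \<open>v\<close> is again an orthogonality relation.\<close>

lemma sum_char_quadric:
  assumes "\<alpha> \<in> dual"
  shows "(\<Sum>v\<in>UNIV. \<Sum>\<phi>\<in>dual. \<psi> (\<phi> u + \<alpha> v + c * \<phi> v)) =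
    (if c \<noteq> 0 then of_nat (card dual) * \<psi> (- \<alpha> u / c)
     else if u = 0 \<and> \<alpha> = (\<lambda>_. 0) then of_nat (card dual) ^ 2 else 0)"
proof -
  have "(\<Sum>\<phi>\<in>dual. \<psi> (\<phi> u + \<alpha> v + c * \<phi> v)) =
      \<psi> (\<alpha> v) * (if u + s c v = 0 then of_nat (card dual) else 0)" for v
  proof -
    have "\<psi> (\<phi> u + \<alpha> v + c * \<phi> v) = \<psi> (\<alpha> v) * \<psi> (\<phi> (u + s c v))" if "\<phi> \<in> dual" for \<phi>
      using that by (simp add: dual_add dual_scale char_add)
    then show ?thesis
      unfolding sum_char_dual[symmetric] sum_distrib_left by simp
  qed
  then have *: "(\<Sum>v\<in>UNIV. \<Sum>\<phi>\<in>dual. \<psi> (\<phi> u + \<alpha> v + c * \<phi> v)) =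
      (\<Sum>v\<in>UNIV. \<psi> (\<alpha> v) * (if u + s c v = 0 then of_nat (card dual) else 0))"
    by simp
  show ?thesis
  proof (cases "c = 0")
    case True
    then show ?thesis
      unfolding *
      by (simp add: sum_char_vectors[OF assms] card_vectors power2_eq_square
          flip: sum_distrib_right)
  next
    case False
    have "u + s c v = 0 \<longleftrightarrow> v = s (- 1 / c) u" for v
    proof
      assume "u + s c v = 0"
      then have "s c v = - u" by (simp add: eq_neg_iff_add_eq_0 add.commute)
      then have "s (1 / c) (s c v) = s (1 / c) (- u)" by simp
      then show "v = s (- 1 / c) u" using False by simp
    qed (use False in simp)
    then show ?thesis
      using False finite_vectors by (simp add: * dual_minus[OF assms] dual_scale[OF assms]
          mult.commute if_distrib cong: if_cong)
  qed
qed

lemma sum_char_cone: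
  assumes "\<alpha> \<in> dual"
  shows "of_nat CARD('k) * (\<Sum>(v, \<phi>)\<in>cone s. \<psi> (\<phi> u + \<alpha> v)) =
    (if u = 0 \<and> \<alpha> = (\<lambda>_. 0) then of_nat (card dual) ^ 2 else 0)
    + of_nat (card dual) * (\<Sum>c\<in>units. \<psi> (c * \<alpha> u))"
proof -
  \<comment> \<open>The factor \<open>q\<close> is absorbed by the indicator of
    \<open>\<phi> v = 0\<close>, since \<open>q\<close> times that indicator is a full character sum
    over the scalars \<open>c\<close>.\<close>
  have "of_nat CARD('k) * (\<Sum>(v, \<phi>)\<in>cone s. \<psi> (\<phi> u + \<alpha> v)) =
      (\<Sum>(v, \<phi>)\<in>UNIV \<times> dual. \<psi> (\<phi> u + \<alpha> v) * (if \<phi> v = 0 then of_nat CARD('k) else 0))"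
    unfolding sum_distrib_left
    using finite_vectors finite_dual
    by (intro sum.mono_neutral_cong_left) (auto simp: cone_def pairing_def split: if_splits)
  also have "\<dots> = (\<Sum>v\<in>UNIV. \<Sum>\<phi>\<in>dual. \<psi> (\<phi> u + \<alpha> v) * (\<Sum>c\<in>UNIV. \<psi> (c * \<phi> v)))"
    by (simp add: sum_char_field sum.cartesian_product)
  also have "\<dots> = (\<Sum>v\<in>UNIV. \<Sum>\<phi>\<in>dual. \<Sum>c\<in>UNIV. \<psi> (\<phi> u + \<alpha> v + c * \<phi> v))"
    by (simp add: char_add sum_distrib_left)
  also have "\<dots> = (\<Sum>v\<in>UNIV. \<Sum>c\<in>UNIV. \<Sum>\<phi>\<in>dual. \<psi> (\<phi> u + \<alpha> v + c * \<phi> v))"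
    by (intro sum.cong refl sum.swap)
  also have "\<dots> = (\<Sum>c\<in>UNIV. \<Sum>v\<in>UNIV. \<Sum>\<phi>\<in>dual. \<psi> (\<phi> u + \<alpha> v + c * \<phi> v))"
    by (rule sum.swap)
  also have "\<dots> = (if u = 0 \<and> \<alpha> = (\<lambda>_. 0) then of_nat (card dual) ^ 2 else 0)
      + (\<Sum>c\<in>units. of_nat (card dual) * \<psi> (- \<alpha> u / c))"
    unfolding sum_char_quadric[OF assms]
    by (subst sum.remove[of UNIV 0]) auto
  \<comment> \<open>Substitute \<open>-1 / c\<close> for \<open>c\<close>.\<close>
  also have "(\<Sum>c\<in>units. of_nat (card dual) * \<psi> (- \<alpha> u / c)) =
      of_nat (card dual) * (\<Sum>c\<in>units. \<psi> (c * \<alpha> u))"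
    using sum.reindex_bij_betw[OF bij_betw_divide_units[of "-1"], of "\<lambda>c. \<psi> (c * \<alpha> u)"]
    by (simp flip: sum_distrib_left)
  finally show ?thesis .
qed

section \<open>The composed kernel\<close>

lemma kloosterman_reindexed: "kloosterman \<psi> a = (\<Sum>t\<in>units. \<psi> (t * a) * \<psi> (1 / t))"
  unfolding kloosterman_def
  \<comment> \<open>Substituting \<open>1 / t\<close> for \<open>t\<close> lets the summation
    variable act as a multiplier; two such sums then combine to the point \<open>a x + b z\<close>
    below.\<close>
  using sum.reindex_bij_betw[OF bij_betw_divide_units[of 1],
      of "\<lambda>t. \<psi> (t * a) * \<psi> (1 / t)"]
  by (simp add: char_add)

text \<open>The polarization of the quadratic form \<open>\<phi> v\<close> that cuts out the
  cone.\<close>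

definition bilin :: "'v \<times> ('v \<Rightarrow> 'k) \<Rightarrow> 'v \<times> ('v \<Rightarrow> 'k) \<Rightarrow> 'k" where
  "bilin x y = pairing (fst x) (snd y) + pairing (fst y) (snd x)"

text \<open>Identifies the support of the \<open>c = 0\<close> term: \<open>a x + b z\<close>
  vanishes only on a line through \<open>z\<close>.\<close>

lemma combination_eq_0_iff:
  assumes "a \<noteq> 0"
  shows "s a u + s b w = 0 \<and> (\<lambda>v. a * \<alpha> v + b * \<gamma> v) = (\<lambda>_. 0) \<longleftrightarrow>
    (u, \<alpha>) = cone_scale s (- b / a) (w, \<gamma>)"
proof -
  have "s a u + s b w = 0 \<longleftrightarrow> u = s (- b / a) w"
  proof
    assume "s a u + s b w = 0"
    then have "s a u = - s b w" by (simp add: eq_neg_iff_add_eq_0)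
    then have "s (1 / a) (s a u) = s (1 / a) (- s b w)" by simp
    then show "u = s (- b / a) w" using assms by simp
  qed (use assms in simp)
  moreover have "a * \<alpha> v + b * \<gamma> v = 0 \<longleftrightarrow> \<alpha> v = - b / a * \<gamma> v" for v
    using assms by (auto simp: field_simps eq_neg_iff_add_eq_0)
  ultimately show ?thesis by (simp add: cone_scale_def fun_eq_iff)
qed

text \<open>With both Kloosterman sums opened, in variables \<open>a\<close> and \<open>b\<close>,
  the sum over \<open>y\<close> is the character sum of the cone at the point
  \<open>a x + b z\<close>.\<close>

lemma kernel_composition:
  assumes "x \<in> cone s" "z \<in> cone s"
  shows "of_nat CARD('k) * (\<Sum>y\<in>cone s. kernel \<psi> x y * kernel \<psi> y z) =
    (\<Sum>a\<in>units. \<Sum>b\<in>units. \<psi> (1 / a + 1 / b) *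
      ((if x = cone_scale s (- b / a) z then of_nat (card dual) ^ 2 else 0)
       + of_nat (card dual) * (\<Sum>c\<in>units. \<psi> (c * (a * b * bilin x z)))))"
proof -
  obtain u \<alpha> where x: "x = (u, \<alpha>)" by force
  obtain w \<gamma> where z: "z = (w, \<gamma>)" by force
  have \<alpha>: "\<alpha> \<in> dual" "\<alpha> u = 0" and \<gamma>: "\<gamma> \<in> dual" "\<gamma> w = 0"
    using assms by (auto simp: x z cone_def pairing_def)
  have "(\<Sum>y\<in>cone s. kernel \<psi> x y * kernel \<psi> y z) =
      (\<Sum>y\<in>cone s. \<Sum>a\<in>units. \<Sum>b\<in>units.
        \<psi> (1 / a + 1 / b) * \<psi> (snd y (s a u + s b w) + (a * \<alpha> (fst y) + b * \<gamma> (fst y))))"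
    unfolding kernel_def kloosterman_reindexed sum_product
    by (intro sum.cong refl)
       (auto simp: x z cone_def pairing_def dual_add dual_scale char_add algebra_simps)
  also have "\<dots> = (\<Sum>a\<in>units. \<Sum>y\<in>cone s. \<Sum>b\<in>units.
        \<psi> (1 / a + 1 / b) * \<psi> (snd y (s a u + s b w) + (a * \<alpha> (fst y) + b * \<gamma> (fst y))))"
    by (rule sum.swap)
  also have "\<dots> = (\<Sum>a\<in>units. \<Sum>b\<in>units. \<Sum>y\<in>cone s.
        \<psi> (1 / a + 1 / b) * \<psi> (snd y (s a u + s b w) + (a * \<alpha> (fst y) + b * \<gamma> (fst y))))"
    by (intro sum.cong refl sum.swap)
  finally have "of_nat CARD('k) * (\<Sum>y\<in>cone s. kernel \<psi> x y * kernel \<psi> y z) =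
      (\<Sum>a\<in>units. \<Sum>b\<in>units. \<psi> (1 / a + 1 / b) * (of_nat CARD('k) *
        (\<Sum>(v, \<phi>)\<in>cone s. \<psi> (\<phi> (s a u + s b w) + (a * \<alpha> v + b * \<gamma> v)))))"
    by (simp add: sum_distrib_left case_prod_unfold mult_ac)
  also have "\<dots> = (\<Sum>a\<in>units. \<Sum>b\<in>units. \<psi> (1 / a + 1 / b) *
      ((if x = cone_scale s (- b / a) z then of_nat (card dual) ^ 2 else 0)
       + of_nat (card dual) * (\<Sum>c\<in>units. \<psi> (c * (a * b * bilin x z)))))"
  proof (intro sum.cong refl)
    fix a b :: 'k assume "a \<in> units"
    then have a: "a \<noteq> 0" by simp
    \<comment> \<open>The quadratic form at \<open>a x + b z\<close>: the square terms drop out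
      because \<open>x\<close> and \<open>z\<close> lie on the cone, leaving only the cross
      term.\<close>
    have "a * \<alpha> (s a u + s b w) + b * \<gamma> (s a u + s b w) = a * b * bilin x z"
      by (simp add: x z bilin_def pairing_def \<alpha> \<gamma> dual_add dual_scale algebra_simps)
    then show "\<psi> (1 / a + 1 / b) * (of_nat CARD('k) *
        (\<Sum>(v, \<phi>)\<in>cone s. \<psi> (\<phi> (s a u + s b w) + (a * \<alpha> v + b * \<gamma> v)))) =
      \<psi> (1 / a + 1 / b) *
      ((if x = cone_scale s (- b / a) z then of_nat (card dual) ^ 2 else 0)
       + of_nat (card dual) * (\<Sum>c\<in>units. \<psi> (c * (a * b * bilin x z))))"
      by (simp only: sum_char_cone[OF dual_combination[OF \<alpha>(1) \<gamma>(1)]]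
          combination_eq_0_iff[OF a] x z)
  qed
  finally show ?thesis .
qed

section \<open>Scaling action and vanishing orbit sums\<close>

lemma cone_scale_in_cone: "x \<in> cone s \<Longrightarrow> cone_scale s c x \<in> cone s"
  by (auto simp: cone_def cone_scale_def pairing_def dual_scale dual_scaled)

lemma cone_scale_scale: "cone_scale s a (cone_scale s b x) = cone_scale s (a * b) x"
  by (simp add: cone_scale_def mult_ac)

lemma cone_scale_one [simp]: "cone_scale s 1 x = x"
  by (simp add: cone_scale_def)

lemma bij_betw_cone_scale: "c \<noteq> 0 \<Longrightarrow> bij_betw (cone_scale s c) (cone s) (cone s)"
  by (rule bij_betwI[where g = "cone_scale s (1 / c)"])
     (auto simp: cone_scale_in_cone cone_scale_scale)

lemma bilin_scale:
  assumes "z \<in> cone s" shows "bilin (cone_scale s c x) z = c * bilin x z"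
  using assms
  by (auto simp: bilin_def cone_def pairing_def cone_scale_def dual_scale algebra_simps)

lemma schwartz_orbit_sum:
  "f \<in> schwartz_space s \<Longrightarrow> x \<in> cone s \<Longrightarrow> (\<Sum>c\<in>units. f (cone_scale s c x)) = 0"
  by (simp add: schwartz_space_def)

text \<open>Rescaling \<open>x\<close> moves \<open>c\<close> from the character onto
  \<open>f\<close>, where summing over \<open>c\<close> produces an orbit sum.\<close>

lemma schwartz_annihilated:
  assumes f: "f \<in> schwartz_space s" and z: "z \<in> cone s"
  shows "(\<Sum>x\<in>cone s. f x * (\<Sum>c\<in>units. \<psi> (c * (k * bilin x z)))) = 0"
proof -
  have "(\<Sum>x\<in>cone s. f x * (\<Sum>c\<in>units. \<psi> (c * (k * bilin x z)))) =
      (\<Sum>c\<in>units. \<Sum>x\<in>cone s. f x * \<psi> (c * (k * bilin x z)))"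
    unfolding sum_distrib_left by (rule sum.swap)
  also have "\<dots> = (\<Sum>c\<in>units. \<Sum>x\<in>cone s. f (cone_scale s (1 / c) x) * \<psi> (k * bilin x z))"
  proof (rule sum.cong[OF refl])
    fix c :: 'k assume "c \<in> units"
    then have c: "c \<noteq> 0" by simp
    show "(\<Sum>x\<in>cone s. f x * \<psi> (c * (k * bilin x z))) =
        (\<Sum>x\<in>cone s. f (cone_scale s (1 / c) x) * \<psi> (k * bilin x z))"
      using sum.reindex_bij_betw[OF bij_betw_cone_scale[OF c],
          of "\<lambda>x. f (cone_scale s (1 / c) x) * \<psi> (k * bilin x z)"] c
      by (simp add: cone_scale_scale bilin_scale[OF z] mult_ac)
  qed
  also have "\<dots> = (\<Sum>x\<in>cone s. (\<Sum>c\<in>units. f (cone_scale s (1 / c) x)) * \<psi> (k * bilin x z))"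
    unfolding sum_distrib_right by (rule sum.swap)
  also have "\<dots> = (\<Sum>x\<in>cone s. (\<Sum>c\<in>units. f (cone_scale s c x)) * \<psi> (k * bilin x z))"
  proof -
    \<comment> \<open>Inversion permutes the units, so this is the orbit sum of \<open>f\<close> at
      \<open>x\<close>.\<close>
    have "(\<Sum>c\<in>units. f (cone_scale s (1 / c) x)) = (\<Sum>c\<in>units. f (cone_scale s c x))" for x
      by (rule sum.reindex_bij_betw[OF bij_betw_divide_units]) simp
    then show ?thesis by simp
  qed
  also have "\<dots> = 0"
    by (simp add: schwartz_orbit_sum[OF f])
  finally show ?thesis .
qed

text \<open>In terms of the ratio \<open>l = - b / a\<close>, the sum over \<open>a\<close> of the
  characters is \<open>q - 1\<close> for \<open>l = 1\<close> and \<open>-1\<close> otherwise. The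
  uniform \<open>-1\<close> gives an orbit sum, which vanishes.\<close>

lemma schwartz_orbit_char_sum:
  assumes f: "f \<in> schwartz_space s" and z: "z \<in> cone s"
  shows "(\<Sum>a\<in>units. \<Sum>b\<in>units. \<psi> (1 / a + 1 / b) * f (cone_scale s (- b / a) z)) =
    of_nat CARD('k) * f z"
proof -
  have "(\<Sum>b\<in>units. \<psi> (1 / a + 1 / b) * f (cone_scale s (- b / a) z)) =
      (\<Sum>l\<in>units. \<psi> (1 / a * (1 - 1 / l)) * f (cone_scale s l z))" if "a \<in> units" for a
  proof -
    have "- a \<noteq> 0" using that by simp
    \<comment> \<open>Substitute \<open>b = - a * l\<close>, so that \<open>1 / a + 1 / b\<close>
      becomes \<open>1 / a * (1 - 1 / l)\<close>.\<close>
    show ?thesis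
      using sum.reindex_bij_betw[OF bij_betw_times_units[OF \<open>- a \<noteq> 0\<close>],
          of "\<lambda>b. \<psi> (1 / a + 1 / b) * f (cone_scale s (- b / a) z)"] that
      by (simp add: right_diff_distrib)
  qed
  then have "(\<Sum>a\<in>units. \<Sum>b\<in>units. \<psi> (1 / a + 1 / b) * f (cone_scale s (- b / a) z)) =
      (\<Sum>a\<in>units. \<Sum>l\<in>units. \<psi> (1 / a * (1 - 1 / l)) * f (cone_scale s l z))"
    by simp
  also have "\<dots> = (\<Sum>l\<in>units. (\<Sum>a\<in>units. \<psi> (1 / a * (1 - 1 / l))) * f (cone_scale s l z))"
    unfolding sum_distrib_right by (rule sum.swap)
  also have "\<dots> = (\<Sum>l\<in>units. (if l = 1 then of_nat CARD('k) * f z else 0) - f (cone_scale s l z))"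
  proof (intro sum.cong refl)
    fix l :: 'k assume "l \<in> units"
    have "(\<Sum>a\<in>units. \<psi> (1 / a * (1 - 1 / l))) = (\<Sum>a\<in>units. \<psi> (a * (1 - 1 / l)))"
      by (rule sum.reindex_bij_betw[OF bij_betw_divide_units[of 1]]) simp
    also have "\<dots> = (if l = 1 then of_nat CARD('k) else 0) - 1"
      using \<open>l \<in> units\<close> unfolding sum_char_units by simp
    finally show "(\<Sum>a\<in>units. \<psi> (1 / a * (1 - 1 / l))) * f (cone_scale s l z) =
        (if l = 1 then of_nat CARD('k) * f z else 0) - f (cone_scale s l z)"
      by (simp add: left_diff_distrib)
  qed
  also have "\<dots> = of_nat CARD('k) * f z"
    by (simp add: sum_subtractf schwartz_orbit_sum[OF f z])
  finally show ?thesis .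
qed

section \<open>The square of the transform\<close>

lemma fourier_fourier:
  assumes f: "f \<in> schwartz_space s" and z: "z \<in> cone s"
  shows "fourier s \<psi> (fourier s \<psi> f) z = of_nat (CARD('k) ^ (2 * dim UNIV)) * f z"
proof -
  let ?D = "of_nat (card dual) :: complex"
  \<comment> \<open>\<open>?I\<close> comes from the scalar \<open>c = 0\<close> in the expansion of
    the cone indicator, and \<open>?R\<close>, up to the factor \<open>?D\<close>, from the nonzero
    \<open>c\<close>.\<close>
  let ?R = "\<lambda>a b x. \<Sum>c\<in>units. \<psi> (c * (a * b * bilin x z))"
  let ?I = "\<lambda>a b x. if x = cone_scale s (- b / a) z then ?D ^ 2 else 0"
  have "fourier s \<psi> (fourier s \<psi> f) z =
      (\<Sum>y\<in>cone s. \<Sum>x\<in>cone s. f x * kernel \<psi> x y * kernel \<psi> y z)"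
    by (simp add: fourier_def sum_distrib_right)
  also have "\<dots> = (\<Sum>x\<in>cone s. \<Sum>y\<in>cone s. f x * kernel \<psi> x y * kernel \<psi> y z)"
    by (rule sum.swap)
  finally have "of_nat CARD('k) * fourier s \<psi> (fourier s \<psi> f) z =
      (\<Sum>x\<in>cone s. f x * (of_nat CARD('k) * (\<Sum>y\<in>cone s. kernel \<psi> x y * kernel \<psi> y z)))"
    by (simp add: sum_distrib_left mult_ac)
  also have "\<dots> = (\<Sum>x\<in>cone s. \<Sum>a\<in>units. \<Sum>b\<in>units. \<psi> (1 / a + 1 / b) *
      (f x * ?I a b x + ?D * (f x * ?R a b x)))"
  proof -
    have "r * (\<Sum>a\<in>units. \<Sum>b\<in>units. p a b * (g a b + e * h a b)) =
        (\<Sum>a\<in>units. \<Sum>b\<in>units. p a b * (r * g a b + e * (r * h a b)))"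
      for r e :: complex and p g h :: "'k \<Rightarrow> 'k \<Rightarrow> complex"
      by (simp add: sum_distrib_left algebra_simps)
    then show ?thesis
      by (intro sum.cong refl) (simp only: kernel_composition[OF _ z])
  qed
  also have "\<dots> = (\<Sum>a\<in>units. \<Sum>x\<in>cone s. \<Sum>b\<in>units. \<psi> (1 / a + 1 / b) *
      (f x * ?I a b x + ?D * (f x * ?R a b x)))"
    by (rule sum.swap)
  also have "\<dots> = (\<Sum>a\<in>units. \<Sum>b\<in>units. \<Sum>x\<in>cone s. \<psi> (1 / a + 1 / b) *
      (f x * ?I a b x + ?D * (f x * ?R a b x)))"
    by (intro sum.cong refl sum.swap)
  also have "\<dots> = (\<Sum>a\<in>units. \<Sum>b\<in>units. \<psi> (1 / a + 1 / b) *
      ((\<Sum>x\<in>cone s. f x * ?I a b x) + ?D * (\<Sum>x\<in>cone s. f x * ?R a b x)))"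
  proof -
    have "(\<Sum>x\<in>cone s. p * (g x + e * h x)) = p * (sum g (cone s) + e * sum h (cone s))"
      for p e :: complex and g h :: "'v \<times> ('v \<Rightarrow> 'k) \<Rightarrow> complex"
      by (simp only: sum.distrib sum_distrib_left distrib_left)
    then show ?thesis by simp
  qed
  also have "\<dots> = (\<Sum>a\<in>units. \<Sum>b\<in>units. \<psi> (1 / a + 1 / b) *
      (?D ^ 2 * f (cone_scale s (- b / a) z)))"
  proof -
    \<comment> \<open>Exactly one point of the cone contributes to the \<open>?I\<close> sum; the
      \<open>?R\<close> sum vanishes by \<open>schwartz_annihilated\<close> with
      \<open>k = a * b\<close>.\<close>
    have "(\<Sum>x\<in>cone s. f x * ?I a b x) = ?D ^ 2 * f (cone_scale s (- b / a) z)" for a b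
      using finite_cone cone_scale_in_cone[OF z] by (simp add: if_distrib cong: if_cong)
    then show ?thesis by (simp only: schwartz_annihilated[OF f z]) simp
  qed
  also have "\<dots> = ?D ^ 2 * (of_nat CARD('k) * f z)"
    unfolding schwartz_orbit_char_sum[OF f z, symmetric] sum_distrib_left
    by (simp only: mult_ac)
  \<comment> \<open>The \<open>q\<close> that cleared the denominator of the indicator cancels
    against the \<open>q\<close> from the orbit sum.\<close>
  finally have "fourier s \<psi> (fourier s \<psi> f) z = ?D ^ 2 * f z" by simp
  then show ?thesis by (simp only: card_dual of_nat_power power_mult[symmetric] mult.commute)
qed

end

theorem theorem6p1:
  fixes s :: "'k::{field,finite} \<Rightarrow> 'v::ab_group_add \<Rightarrow> 'v"
    and B :: "'v set"
    and d :: nat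
    and \<psi> :: "'k \<Rightarrow> complex"
    and f :: "'v \<times> ('v \<Rightarrow> 'k) \<Rightarrow> complex"
  assumes "finite_dimensional_vector_space s B"
    and "vector_space.dim s (UNIV :: 'v set) = d"
    and "nontrivial_additive_character \<psi>"
    and "f \<in> schwartz_space s"
  shows "\<forall>y\<in>cone s. (fourier s \<psi> \<circ> fourier s \<psi>) f y = of_nat (CARD('k) ^ (2 * d)) * f y"
proof -
  interpret finite_quadric_cone s B \<psi>
    using assms(1,3) by (simp add: finite_quadric_cone_def finite_quadric_cone_axioms_def)
  show ?thesis
    using fourier_fourier[OF assms(4)] assms(2) by simp
qed

end
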